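(* Let $r=(i_0,i_1,\ldots,i_h,i_{h+1})$ be a route with $i_0=i_{h+1}=0$, and let $(\mathbf{v},\mathbf{t})$ be any optimal solution of the speed optimization problem over $r$ (stated in the context), so that $\mathbf v=(v_{i_{l-1},i_l})_{l=1}^{h+1}$ is an optimal speed vector with service start times $\mathbf t=(t_{i_l})_{l=0}^{h+1}$. Then the speed is uniform between any two consecutive active customers; that is, for any non-active customer $i_l$ ($1\le l\le h$), the speed on the arc entering the customer equals the speed on the arc emanating from that customer: $$v_{i_{l-1},i_l}=v_{i_l,i_{l+1}}.$$
   Context: Let $V=\{0,1,\ldots,n\}$, where $0$ is the depot and $V_0=\{1,\ldots,n\}$ is the set of customers, be the vertex set of a complete directed graph. Each arc $(i,j)$ has a distance $d_{ij}>0$. Each customer $i\in V_0$ has a service time window $[a_i,b_i]$ and a service duration $\tau_i\ge 0$; the depot has time window $[a_0,b_0]$ and $\tau_0=0$. The fuel consumption per unit distance at speed $v>0$ is $f(v)$, where $f$ is strictly convex and differentiable. All speeds are bounded above by a common limit $u$, and $v_F$ denotes the speed that minimizes $f$ (speeds below $v_F$ are never used). A route is a walk $(i_0,i_1,\ldots,i_h,i_{h+1})$ with $i_0=i_{h+1}=0$ and $i_j\in V_0$ for $1\le j\le h$; speeds and times are indexed by position along the walk, so a repeated vertex or arc has separate variables at each occurrence. The speed optimization problem over $r$ is: minimize $\sum_{l=1}^{h+1} d_{i_{l-1},i_l} f(v_{i_{l-1},i_l})$ over speeds $v_{i_{l-1},i_l}$ and times $t_{i_l}$ subject to $t_{i_l}\ge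 t_{i_{l-1}}+\tau_{i_{l-1}}+d_{i_{l-1},i_l}/v_{i_{l-1},i_l}$ for $l=1,\ldots,h+1$; $a_{i_l}\le t_{i_l}\le b_{i_l}$ for $l=1,\ldots,h+1$ (with $a_{i_{h+1}}=a_0$, $b_{i_{h+1}}=b_0$); $t_{i_0}=0$; and $v_F\le v_{i_{l-1},i_l}\le u$ for $l=1,\ldots,h+1$. A customer $i_l$ is active if its service starts at its earliest or latest available time, i.e. $t_{i_l}\in\{a_{i_l},b_{i_l}\}$; otherwise (i.e. $a_{i_l}<t_{i_l}<b_{i_l}$) it is non-active. *)

theory Defs
  imports "HOL-Analysis.Analysis"
begin

definition strictly_convex_on :: "real set \<Rightarrow> (real \<Rightarrow> real) \<Rightarrow> bool" where
  "strictly_convex_on S f \<longleftrightarrow> convex S \<and>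
     (\<forall>x\<in>S. \<forall>y\<in>S. \<forall>s. x \<noteq> y \<and> 0 < s \<and> s < 1 \<longrightarrow>
        f ((1 - s) * x + s * y) < (1 - s) * f x + s * f y)"

(* A route with h customer visits is the walk r 0, ..., r (h + 1) in the complete directed graph
   on {0..n}, with depot 0. The graph has no loops, so consecutive vertices differ; vertices and
   arcs may otherwise repeat. *)
definition route :: "nat \<Rightarrow> nat \<Rightarrow> (nat \<Rightarrow> nat) \<Rightarrow> bool" where
  "route n h r \<longleftrightarrow> r 0 = 0 \<and> r (h + 1) = 0 \<and>
     (\<forall>l\<in>{1..h}. r l \<in> {1..n}) \<and> (\<forall>l\<in>{1..h+1}. r (l - 1) \<noteq> r l)"

(* Variables are indexed by position: v l (1 <= l <= h + 1) is the speed on the arc from r (l - 1)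
   to r l, and t l (0 <= l <= h + 1) is the service start time at r l. Values of v and t at other
   positions are unconstrained and irrelevant. *)
definition fuel_cost ::
  "(nat \<Rightarrow> nat \<Rightarrow> real) \<Rightarrow> (real \<Rightarrow> real) \<Rightarrow> nat \<Rightarrow> (nat \<Rightarrow> nat) \<Rightarrow> (nat \<Rightarrow> real) \<Rightarrow> real" where
  "fuel_cost d f h r v = (\<Sum>l=1..h+1. d (r (l - 1)) (r l) * f (v l))"

definition speed_feasible ::
  "(nat \<Rightarrow> nat \<Rightarrow> real) \<Rightarrow> (nat \<Rightarrow> real) \<Rightarrow> (nat \<Rightarrow> real) \<Rightarrow> (nat \<Rightarrow> real) \<Rightarrow> real \<Rightarrow> real \<Rightarrow>
   nat \<Rightarrow> (nat \<Rightarrow> nat) \<Rightarrow> (nat \<Rightarrow> real) \<Rightarrow> (nat \<Rightarrow> real) \<Rightarrow> bool" where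
  "speed_feasible d a b \<tau> vF u h r v t \<longleftrightarrow>
     (\<forall>l\<in>{1..h+1}. t l \<ge> t (l - 1) + \<tau> (r (l - 1)) + d (r (l - 1)) (r l) / v l) \<and>
     (\<forall>l\<in>{1..h+1}. a (r l) \<le> t l \<and> t l \<le> b (r l)) \<and>
     t 0 = 0 \<and>
     (\<forall>l\<in>{1..h+1}. vF \<le> v l \<and> v l \<le> u)"

definition speed_optimal ::
  "(nat \<Rightarrow> nat \<Rightarrow> real) \<Rightarrow> (nat \<Rightarrow> real) \<Rightarrow> (nat \<Rightarrow> real) \<Rightarrow> (nat \<Rightarrow> real) \<Rightarrow> (real \<Rightarrow> real) \<Rightarrow>
   real \<Rightarrow> real \<Rightarrow> nat \<Rightarrow> (nat \<Rightarrow> nat) \<Rightarrow> (nat \<Rightarrow> real) \<Rightarrow> (nat \<Rightarrow> real) \<Rightarrow> bool" where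
  "speed_optimal d a b \<tau> f vF u h r v t \<longleftrightarrow>
     is_arg_min (\<lambda>(v', t'). fuel_cost d f h r v')
       (\<lambda>(v', t'). speed_feasible d a b \<tau> vF u h r v' t') (v, t)"

definition active ::
  "(nat \<Rightarrow> real) \<Rightarrow> (nat \<Rightarrow> real) \<Rightarrow> (nat \<Rightarrow> nat) \<Rightarrow> (nat \<Rightarrow> real) \<Rightarrow> nat \<Rightarrow> bool" where
  "active a b r t l \<longleftrightarrow> t l \<in> {a (r l), b (r l)}"

end

theory Submission
  imports Defs
begin

text \<open>
  Suppose the speeds $x$ and $y$ on two consecutive arcs, of lengths $p$ and $q$, differ, and let
  $w$ be their harmonic mean with weights $p$ and $q$. Driving both arcs at speed $w$ takes the same
  total time. It costs no more fuel, because $w$ is at most the arithmetic mean, the fuel rate is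
  increasing to the right of its minimizer, and it is convex
  (\<open>common_speed_of_same_duration\<close>). The only constraint that this replacement can violate is the time
  window of the customer in between, since it may move the service time there by a large amount.

  If that customer is non-active, a small step from the given solution towards the common speed $w$
  stays inside the window. All other constraints survive every such step, because travel time is a
  convex function of speed. At least one of $x$ and $y$ differs from $w$, so strict convexity of the
  fuel rate makes the step strictly lower the cost, which contradicts optimality
  (\<open>speed_equal_at_non_active\<close>). The statement about consecutive active customers follows by
  chaining these equalities.
\<close>

section \<open>Convexity of fuel rate and travel time\<close>

lemma strictly_convex_on_imp_convex_on:
  assumes "strictly_convex_on S f"
  shows "convex_on S f"
proof (rule convex_onI)
  show "convex S"
    using assms by (simp add: strictly_convex_on_def)
  fix s x y :: real
  assume "0 < s" "s < 1" "x \<in> S" "y \<in> S"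
  then show "f ((1 - s) *\<^sub>R x + s *\<^sub>R y) \<le> (1 - s) * f x + s * f y"
    using assms
    by (cases "x = y") (auto simp: strictly_convex_on_def simp flip: distrib_right intro: less_imp_le)
qed

lemma convex_on_mono_above_minimizer:
  fixes f :: "real \<Rightarrow> real"
  assumes f: "convex_on S f" and "c \<in> S" "y \<in> S" and min: "f c \<le> f y" and "c \<le> x" "x \<le> y"
  shows "f x \<le> f y"
proof (cases "x = c")
  case True
  then show ?thesis using min by simp
next
  case False
  then have "c < y" using assms by simp
  define s where "s = (x - c) / (y - c)"
  have s: "0 \<le> s" "s \<le> 1" using assms \<open>c < y\<close> by (simp_all add: s_def)
  have "s * (y - c) = x - c" using \<open>c < y\<close> by (simp add: s_def)
  then have "x = (1 - s) * c + s * y" by (simp add: algebra_simps)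
  then have "f x \<le> (1 - s) * f c + s * f y"
    using convex_onD[OF f s \<open>c \<in> S\<close> \<open>y \<in> S\<close>] by simp
  also have "\<dots> \<le> (1 - s) * f y + s * f y"
    using s min by (intro add_right_mono mult_left_mono) auto
  finally show ?thesis by (simp add: algebra_simps)
qed

lemma travel_time_convex:
  fixes x w D s :: real
  assumes "0 < x" "0 < w" "0 \<le> D" "0 \<le> s" "s \<le> 1"
  shows "D / ((1 - s) * x + s * w) \<le> (1 - s) * (D / x) + s * (D / w)"
proof -
  have "inverse ((1 - s) *\<^sub>R x + s *\<^sub>R w) \<le> (1 - s) * inverse x + s * inverse w"
    using assms convex_onD[OF convex_on_inverse[of "{0<..}"]] by simp
  then have "D * inverse ((1 - s) * x + s * w) \<le> D * ((1 - s) * inverse x + s * inverse w)"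
    using \<open>0 \<le> D\<close> by (intro mult_left_mono) auto
  then show ?thesis by (simp add: field_simps)
qed

section \<open>A common speed for two arcs\<close>

text \<open>The witness is the weighted harmonic mean, the only speed that preserves the total travel
  time. Jensen's inequality bounds the cost at the arithmetic mean, and the inequality between the
  two means turns this into a bound at the harmonic mean because $f$ is increasing to the right of $c$.\<close>

lemma common_speed_of_same_duration:
  fixes f :: "real \<Rightarrow> real"
  assumes f: "convex_on {0<..} f" and min: "\<And>z. z > 0 \<Longrightarrow> f c \<le> f z"
    and "0 < c" "0 < p" "0 < q" and x: "c \<le> x" "x \<le> u" and y: "c \<le> y" "y \<le> u"
  obtains w where "c \<le> w" "w \<le> u" "p / w + q / w = p / x + q / y"
    "p * f w + q * f w \<le> p * f x + q * f y"
proof -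
  define T where "T = p / x + q / y"
  define w where "w = (p + q) / T"
  define s where "s = q / (p + q)"
  define m where "m = (1 - s) * x + s * y"
  have pos: "0 < x" "0 < y" "0 < u" using assms by auto
  then have "0 < T" using assms by (simp add: T_def add_pos_pos)
  have s: "0 \<le> s" "s \<le> 1" using assms by (simp_all add: s_def)
  have sp: "(p + q) * (1 - s) = p" "(p + q) * s = q"
    using assms by (simp_all add: s_def field_simps)
  have "0 < m" using pos s by (cases "s = 1") (auto simp: m_def intro: add_pos_nonneg)
  have "p / x \<le> p / c" "q / y \<le> q / c" "p / u \<le> p / x" "q / u \<le> q / y"
    using assms pos by (auto intro!: divide_left_mono)
  then have "T \<le> (p + q) / c" "(p + q) / u \<le> T" by (simp_all add: T_def add_divide_distrib)
  then have w: "c \<le> w" "w \<le> u"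
    using \<open>0 < T\<close> \<open>0 < c\<close> \<open>0 < u\<close> by (simp_all add: w_def field_simps)
  have same: "p / w + q / w = p / x + q / y"
  proof -
    have "p / w + q / w = (p + q) / w" by (rule add_divide_distrib[symmetric])
    also have "\<dots> = T" using assms by (simp add: w_def)
    finally show ?thesis by (simp only: T_def)
  qed
  have "(p + q) / m \<le> (p + q) * ((1 - s) * (1 / x) + s * (1 / y))"
    using travel_time_convex[OF pos(1,2) _ s, of 1] assms
      mult_left_mono[of "1 / m" "(1 - s) * (1 / x) + s * (1 / y)" "p + q"]
    by (simp add: m_def)
  also have "\<dots> = ((p + q) * (1 - s)) / x + ((p + q) * s) / y"
    by (simp add: distrib_left)
  also have "\<dots> = T" by (simp only: sp T_def)
  finally have "w \<le> m" using \<open>0 < T\<close> \<open>0 < m\<close> by (simp add: w_def field_simps)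
  then have "f w \<le> f m"
    using convex_on_mono_above_minimizer[OF f _ _ min] \<open>0 < m\<close> \<open>0 < c\<close> w by simp
  also have "f m \<le> (1 - s) * f x + s * f y"
    using convex_onD[OF f s, of x y] pos by (simp add: m_def)
  finally have "(p + q) * f w \<le> (p + q) * ((1 - s) * f x + s * f y)"
    using assms by (intro mult_left_mono) auto
  also have "\<dots> = ((p + q) * (1 - s)) * f x + ((p + q) * s) * f y"
    by (simp add: distrib_left)
  also have "\<dots> = p * f x + q * f y" by (simp only: sp)
  finally show thesis using that[OF w same] by (simp add: distrib_right)
qed

section \<open>Changing the speeds around one customer\<close>

lemma fuel_cost_update_two_arcs:
  assumes "l \<in> {1..h}"
  shows "fuel_cost d f h r (v(l := x, l + 1 := y)) - fuel_cost d f h r v =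
    (d (r (l - 1)) (r l) * f x + d (r l) (r (l + 1)) * f y) -
    (d (r (l - 1)) (r l) * f (v l) + d (r l) (r (l + 1)) * f (v (l + 1)))"
proof -
  have split: "fuel_cost d f h r w = (\<Sum>k\<in>{1..h+1} - {l, l + 1}. d (r (k - 1)) (r k) * f (w k)) +
      (d (r (l - 1)) (r l) * f (w l) + d (r l) (r (l + 1)) * f (w (l + 1)))" for w
    unfolding fuel_cost_def
    using assms by (subst sum.subset_diff[of "{l, l + 1}"]) auto
  have "(\<Sum>k\<in>{1..h+1} - {l, l + 1}. d (r (k - 1)) (r k) * f ((v(l := x, l + 1 := y)) k)) =
      (\<Sum>k\<in>{1..h+1} - {l, l + 1}. d (r (k - 1)) (r k) * f (v k))"
    by (intro sum.cong) auto
  then show ?thesis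
    unfolding split[of v] split[of "v(l := x, l + 1 := y)"] by simp
qed

lemma speed_feasible_update_two_arcs:
  assumes feas: "speed_feasible d a b \<tau> vF u h r v t" and l: "l \<in> {1..h}"
    and "t (l - 1) + \<tau> (r (l - 1)) + d (r (l - 1)) (r l) / x \<le> z"
    and "z + \<tau> (r l) + d (r l) (r (l + 1)) / y \<le> t (l + 1)"
    and "a (r l) \<le> z" "z \<le> b (r l)" "vF \<le> x" "x \<le> u" "vF \<le> y" "y \<le> u"
  shows "speed_feasible d a b \<tau> vF u h r (v(l := x, l + 1 := y)) (t(l := z))"
proof -
  have "(t(l := z)) k \<ge> (t(l := z)) (k - 1) + \<tau> (r (k - 1)) +
      d (r (k - 1)) (r k) / (v(l := x, l + 1 := y)) k" if k: "k \<in> {1..h+1}" for k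
  proof -
    consider "k = l" | "k = l + 1" | "k \<noteq> l" "k - 1 \<noteq> l" "k \<noteq> l + 1" using k by fastforce
    then show ?thesis
    proof cases
      case 1
      then show ?thesis using assms by auto
    next
      case 2
      then show ?thesis using assms by auto
    next
      case 3
      then show ?thesis using feas k by (auto simp: speed_feasible_def)
    qed
  qed
  then show ?thesis using assms by (auto simp: speed_feasible_def)
qed

lemma small_step_stays_in_interval:
  fixes z z' lo hi :: real
  assumes "lo < z" "z < hi"
  obtains s where "0 < s" "s < 1" "lo < (1 - s) * z + s * z'" "(1 - s) * z + s * z' < hi"
proof -
  have lim: "((\<lambda>s. (1 - s) * z + s * z') \<longlongrightarrow> (1 - 0) * z + 0 * z') (at_right 0)"
    by (intro tendsto_intros)
  have "\<forall>\<^sub>F s in at_right 0. lo < (1 - s) * z + s * z'"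
    using order_tendstoD(1)[OF lim, of lo] assms by simp
  moreover have "\<forall>\<^sub>F s in at_right 0. (1 - s) * z + s * z' < hi"
    using order_tendstoD(2)[OF lim, of hi] assms by simp
  moreover have "\<forall>\<^sub>F s in at_right 0. 0 < s \<and> s < (1::real)"
    using eventually_at_right_real[of 0 1] by simp
  ultimately have "\<forall>\<^sub>F s in at_right 0.
      0 < s \<and> s < 1 \<and> lo < (1 - s) * z + s * z' \<and> (1 - s) * z + s * z' < hi"
    by eventually_elim auto
  from eventually_happens'[OF trivial_limit_at_right_real this] show thesis
    by (elim exE conjE) (rule that)
qed

section \<open>Uniform speed around non-active customers\<close>

text \<open>The exchange argument: if the two speeds differed, moving both speeds and the service time a
  small step, by one common fraction, towards the solution with a common speed would be feasible and
  strictly cheaper.\<close>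

lemma speed_equal_at_non_active:
  assumes f: "strictly_convex_on {0<..} f" and vF: "is_arg_min f (\<lambda>x. x > 0) vF"
    and opt: "speed_optimal d a b \<tau> f vF u h r v t"
    and l: "l \<in> {1..h}" and nonact: "\<not> active a b r t l"
    and D: "0 < d (r (l - 1)) (r l)" "0 < d (r l) (r (l + 1))"
  shows "v l = v (l + 1)"
proof (rule ccontr)
  assume neq: "v l \<noteq> v (l + 1)"
  define p where "p = d (r (l - 1)) (r l)"
  define q where "q = d (r l) (r (l + 1))"
  define x where "x = v l"
  define y where "y = v (l + 1)"
  have pq: "0 < p" "0 < q" using D by (simp_all add: p_def q_def)
  have feas: "speed_feasible d a b \<tau> vF u h r v t"
    and least: "\<And>v' t'. speed_feasible d a b \<tau> vF u h r v' t' \<Longrightarrow>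
      fuel_cost d f h r v \<le> fuel_cost d f h r v'"
    using opt by (auto simp: speed_optimal_def is_arg_min_linorder)
  have min: "0 < vF" "\<And>z. z > 0 \<Longrightarrow> f vF \<le> f z"
    using vF by (auto simp: is_arg_min_linorder)
  have xy: "vF \<le> x" "x \<le> u" "vF \<le> y" "y \<le> u"
    and tl: "t (l - 1) + \<tau> (r (l - 1)) + p / x \<le> t l"
    and window: "a (r l) \<le> t l" "t l \<le> b (r l)"
    using feas l by (auto simp: speed_feasible_def x_def y_def p_def)
  have tl': "t l + \<tau> (r l) + q / y \<le> t (l + 1)"
  proof -
    have "l + 1 \<in> {1..h+1}" using l by simp
    then have "t (l + 1 - 1) + \<tau> (r (l + 1 - 1)) + d (r (l + 1 - 1)) (r (l + 1)) / v (l + 1)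
        \<le> t (l + 1)"
      using feas unfolding speed_feasible_def by blast
    then show ?thesis by (simp add: y_def q_def)
  qed
  have cvx: "convex_on {0<..} f" using f by (rule strictly_convex_on_imp_convex_on)
  obtain w where w: "vF \<le> w" "w \<le> u" and same: "p / w + q / w = p / x + q / y"
    and cost: "p * f w + q * f w \<le> p * f x + q * f y"
    by (rule common_speed_of_same_duration[OF cvx min(2) min(1) pq xy])
  have pos: "0 < x" "0 < y" "0 < w" using min(1) xy w by auto
  \<comment> \<open>The earliest arrival at position \<open>l\<close> at speed \<open>w\<close>, with the previous service time kept; it may
    lie outside the window.\<close>
  define z where "z = t (l - 1) + \<tau> (r (l - 1)) + p / w"
  have "a (r l) < t l" "t l < b (r l)"
    using window nonact by (auto simp: active_def)
  then obtain s where s: "0 < s" "s < 1"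
    and zs: "a (r l) < (1 - s) * t l + s * z" "(1 - s) * t l + s * z < b (r l)"
    by (rule small_step_stays_in_interval)
  define x' where "x' = (1 - s) * x + s * w"
  define y' where "y' = (1 - s) * y + s * w"
  define z' where "z' = (1 - s) * t l + s * z"
  have bounds: "vF \<le> x'" "x' \<le> u" "vF \<le> y'" "y' \<le> u"
    using convexD_alt[OF convex_real_interval(5)[of vF u], of _ w s] s w xy
    by (auto simp: x'_def y'_def)
  \<comment> \<open>Both travel constraints hold at the given solution and at the solution with common speed
    \<open>w\<close>, and convexity of travel time passes them on to the combination.\<close>
  have arr: "t (l - 1) + \<tau> (r (l - 1)) + p / x' \<le> z'"
  proof -
    have "p / x' \<le> (1 - s) * (p / x) + s * (p / w)"
      using travel_time_convex[of x w p s] pos pq s by (simp add: x'_def)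
    moreover have "(1 - s) * (t (l - 1) + \<tau> (r (l - 1)) + p / x) \<le> (1 - s) * t l"
      using tl s by (intro mult_left_mono) auto
    ultimately show ?thesis by (simp add: z'_def z_def algebra_simps)
  qed
  have dep: "z' + \<tau> (r l) + q / y' \<le> t (l + 1)"
  proof -
    have "q / y' \<le> (1 - s) * (q / y) + s * (q / w)"
      using travel_time_convex[of y w q s] pos pq s by (simp add: y'_def)
    moreover have "(1 - s) * (t l + \<tau> (r l) + q / y) \<le> (1 - s) * t (l + 1)"
      using tl' s by (intro mult_left_mono) auto
    moreover have "s * (z + \<tau> (r l) + q / w) \<le> s * t (l + 1)"
      using tl tl' same s by (intro mult_left_mono) (auto simp: z_def)
    ultimately show ?thesis by (simp add: z'_def algebra_simps)
  qed
  have "speed_feasible d a b \<tau> vF u h r (v(l := x', l + 1 := y')) (t(l := z'))"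
    using speed_feasible_update_two_arcs[OF feas l] arr dep zs bounds
    by (simp add: p_def q_def z'_def)
  from least[OF this] have no_gain: "p * f x + q * f y \<le> p * f x' + q * f y'"
    using fuel_cost_update_two_arcs[OF l, of d f r v x' y']
    by (simp add: p_def q_def x_def y_def)
  have le: "f ((1 - s) * c + s * w) \<le> (1 - s) * f c + s * f w" if "0 < c" for c
    using convex_onD[OF cvx, of s c w] s pos that by simp
  have less: "f ((1 - s) * c + s * w) < (1 - s) * f c + s * f w" if "0 < c" "c \<noteq> w" for c
    using f s pos that by (auto simp: strictly_convex_on_def)
  have "p * f x' + q * f y' < p * ((1 - s) * f x + s * f w) + q * ((1 - s) * f y + s * f w)"
  proof (cases "x = w")
    case True
    then have "y \<noteq> w" using neq by (auto simp: x_def y_def)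
    then show ?thesis
      unfolding x'_def y'_def
      using le less pos pq by (intro add_le_less_mono mult_left_mono mult_strict_left_mono) auto
  next
    case False
    then show ?thesis
      unfolding x'_def y'_def
      using le less pos pq by (intro add_less_le_mono mult_left_mono mult_strict_left_mono) auto
  qed
  also have "\<dots> = (1 - s) * (p * f x + q * f y) + s * (p * f w + q * f w)"
    by (simp add: algebra_simps)
  also have "\<dots> \<le> (1 - s) * (p * f x + q * f y) + s * (p * f x + q * f y)"
    using cost s by (intro add_left_mono mult_left_mono) auto
  also have "\<dots> = p * f x + q * f y" by (simp add: algebra_simps)
  finally show False using no_gain by simp
qed

lemma route_arc_vertices:
  assumes "route n h r" "l \<in> {1..h+1}"
  shows "r (l - 1) \<in> {0..n}" "r l \<in> {0..n}" "r (l - 1) \<noteq> r l"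
proof -
  have ends: "r 0 = 0" "r (h + 1) = 0" and customers: "\<forall>k\<in>{1..h}. r k \<in> {1..n}"
    and loopless: "\<forall>k\<in>{1..h+1}. r (k - 1) \<noteq> r k"
    by (insert assms(1), unfold route_def, (elim conjE, assumption)+)
  have vert: "r k \<in> {0..n}" if "k \<le> h + 1" for k
  proof -
    consider "k = 0" | "k = h + 1" | "k \<in> {1..h}" using \<open>k \<le> h + 1\<close> by fastforce
    then show ?thesis
    proof cases
      case 3
      then have "r k \<in> {1..n}" using customers by blast
      then show ?thesis by simp
    qed (simp_all only: ends, simp_all)
  qed
  have "l - 1 \<le> h + 1" "l \<le> h + 1" using assms(2) by auto
  then show "r (l - 1) \<in> {0..n}" "r l \<in> {0..n}" by (simp_all only: vert)
  show "r (l - 1) \<noteq> r l" using loopless assms(2) by blast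
qed

theorem proposition1:
  fixes n h :: nat
    and d :: "nat \<Rightarrow> nat \<Rightarrow> real"
    and a b \<tau> :: "nat \<Rightarrow> real"
    and f :: "real \<Rightarrow> real"
    and vF u :: real
    and r :: "nat \<Rightarrow> nat"
    and v t :: "nat \<Rightarrow> real"
  assumes "\<And>i j. i \<in> {0..n} \<Longrightarrow> j \<in> {0..n} \<Longrightarrow> i \<noteq> j \<Longrightarrow> d i j > 0"
    and "\<And>i. i \<in> {1..n} \<Longrightarrow> \<tau> i \<ge> 0" and "\<tau> 0 = 0"
    and "strictly_convex_on {0<..} f" and "f differentiable_on {0<..}"
    and "is_arg_min f (\<lambda>x. x > 0) vF"
    and "route n h r"
    and "speed_optimal d a b \<tau> f vF u h r v t"
  shows "(\<forall>p q. 1 \<le> p \<and> p < q \<and> q \<le> h \<and> active a b r t p \<and> active a b r t q \<and>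
            (\<forall>l\<in>{p<..<q}. \<not> active a b r t l) \<longrightarrow>
            (\<forall>k\<in>{p<..q}. \<forall>m\<in>{p<..q}. v k = v m)) \<and>
         (\<forall>l\<in>{1..h}. \<not> active a b r t l \<longrightarrow> v l = v (l + 1))"
proof -
  have pos: "0 < d (r (l - 1)) (r l)" if "l \<in> {1..h+1}" for l
    using assms(1) route_arc_vertices[OF assms(7) that] by simp
  have eq: "v l = v (l + 1)" if l: "l \<in> {1..h}" and "\<not> active a b r t l" for l
  proof (rule speed_equal_at_non_active[OF assms(4,6,8) that])
    show "0 < d (r (l - 1)) (r l)" using l by (intro pos) simp
    show "0 < d (r l) (r (l + 1))" using pos[of "l + 1"] l by simp
  qed
  have "v k = v m"
    if pq: "1 \<le> p" "q \<le> h" and gap: "\<forall>l\<in>{p<..<q}. \<not> active a b r t l"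
      and km: "k \<in> {p<..q}" "m \<in> {p<..q}" for p q k m
  proof -
    have chain: "v j = v q" if "p < j" "j \<le> q" for j
      using that(2,1)
    proof (induction rule: inc_induct)
      case (step i)
      then have "v i = v (i + 1)" using gap pq by (intro eq) auto
      then show ?case using step by simp
    qed simp
    have "v k = v q" "v m = v q" using km by (auto intro!: chain)
    then show ?thesis by (rule trans[OF _ sym])
  qed
  then show ?thesis using eq by blast
qed

end
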